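(* For every $\mu>0$, the central path point $z^{\mathrm{cp}}(\mu)=(x^{\mathrm{cp}}(\mu),s^{\mathrm{cp}}(\mu))$ and the max central path satisfy, coordinatewise, $$\frac{z^{\mathfrak m}(n\mu)}{2n}\le z^{\mathrm{cp}}(\mu)\le z^{\mathfrak m}(n\mu).$$
   Context: $A\in\mathbb R^{m\times n}$ has rank $m\le n$, $b\in\mathbb R^m$, $c\in\mathbb R^n$. The primal-dual pair is $\min\{\langle c,x\rangle: Ax=b,\ x\ge 0\}$ and $\max\{\langle b,y\rangle: A^\top y+s=c,\ s\ge 0\}$, feasible and bounded with optimal value $v^\star$. Both the primal and the dual are assumed to have strictly feasible points (i.e. feasible $x>0$, respectively feasible $s>0$). Central path: for $\mu>0$, $(x^{\mathrm{cp}}(\mu),y^{\mathrm{cp}}(\mu),s^{\mathrm{cp}}(\mu))$ is the unique solution of $Ax=b$, $x>0$, $A^\top y+s=c$, $s>0$, $x_is_i=\mu$ for all $i\in[n]$. Max central path: for $g\ge0$, $z^{\mathfrak m}(g)=(x^{\mathfrak m}(g),s^{\mathfrak m}(g))\in\mathbb R^{2n}_+$, where for each $i\in[n]$, $x^{\mathfrak m}_i(g)=\max\{x_i: Ax=b,\ x\ge0,\ \langle c,x\rangle\le v^\star+g\}$ and $s^{\mathfrak m}_i(g)=\max\{s_i: A^\top y+s=c,\ s\ge0,\ \langle b,y\rangle\ge v^\star-g\}$. *)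

theory Defs
  imports "HOL-Analysis.Analysis"
begin

definition primal_feasible :: "real ^ 'n ^ 'm \<Rightarrow> real ^ 'm \<Rightarrow> (real ^ 'n) set" where
  "primal_feasible A b = {x. A *v x = b \<and> (\<forall>i. 0 \<le> x $ i)}"

definition dual_feasible ::
    "real ^ 'n ^ 'm \<Rightarrow> real ^ 'n \<Rightarrow> ((real ^ 'm) \<times> (real ^ 'n)) set" where
  "dual_feasible A c = {(y, s). transpose A *v y + s = c \<and> (\<forall>i. 0 \<le> s $ i)}"

definition primal_strictly_feasible :: "real ^ 'n ^ 'm \<Rightarrow> real ^ 'm \<Rightarrow> (real ^ 'n) set" where
  "primal_strictly_feasible A b = {x. A *v x = b \<and> (\<forall>i. 0 < x $ i)}"

definition dual_strictly_feasible ::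
    "real ^ 'n ^ 'm \<Rightarrow> real ^ 'n \<Rightarrow> ((real ^ 'm) \<times> (real ^ 'n)) set" where
  "dual_strictly_feasible A c = {(y, s). transpose A *v y + s = c \<and> (\<forall>i. 0 < s $ i)}"

text \<open>
  The minimum (\<open>LEAST\<close>) and the maxima (\<open>GREATEST\<close>) below are meaningful only if they are
  attained, which holds when both programs have strictly feasible points (and \<open>g \<ge> 0\<close>).
  By strong duality the primal minimum is also the maximum of the dual program.
\<close>

definition optimal_value :: "real ^ 'n ^ 'm \<Rightarrow> real ^ 'm \<Rightarrow> real ^ 'n \<Rightarrow> real" where
  "optimal_value A b c = (LEAST v. v \<in> (\<lambda>x. c \<bullet> x) ` primal_feasible A b)"

definition central_path ::
    "real ^ 'n ^ 'm \<Rightarrow> real ^ 'm \<Rightarrow> real ^ 'n \<Rightarrow> real \<Rightarrow> (real ^ 'n) \<times> (real ^ 'm) \<times> (real ^ 'n)" where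
  "central_path A b c \<mu> =
     (THE (x, y, s). x \<in> primal_strictly_feasible A b \<and> (y, s) \<in> dual_strictly_feasible A c \<and>
        (\<forall>i. x $ i * s $ i = \<mu>))"

definition z_cp ::
    "real ^ 'n ^ 'm \<Rightarrow> real ^ 'm \<Rightarrow> real ^ 'n \<Rightarrow> real \<Rightarrow> (real ^ 'n) \<times> (real ^ 'n)" where
  "z_cp A b c \<mu> = (case central_path A b c \<mu> of (x, y, s) \<Rightarrow> (x, s))"

definition x_max :: "real ^ 'n ^ 'm \<Rightarrow> real ^ 'm \<Rightarrow> real ^ 'n \<Rightarrow> real \<Rightarrow> real ^ 'n" where
  "x_max A b c g =
     (\<chi> i. GREATEST t. t \<in> {x $ i | x. x \<in> primal_feasible A b \<and> c \<bullet> x \<le> optimal_value A b c + g})"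

definition s_max :: "real ^ 'n ^ 'm \<Rightarrow> real ^ 'm \<Rightarrow> real ^ 'n \<Rightarrow> real \<Rightarrow> real ^ 'n" where
  "s_max A b c g =
     (\<chi> i. GREATEST t. t \<in> {s $ i | y s. (y, s) \<in> dual_feasible A c \<and> b \<bullet> y \<ge> optimal_value A b c - g})"

text \<open>
  Points of \<open>\<real>\<^sup>2\<^sup>n\<close> are pairs in \<open>(real ^ 'n) \<times> (real ^ 'n)\<close>; the library order \<open>\<le>\<close> on this type is
  the coordinatewise one.
\<close>

definition z_max ::
    "real ^ 'n ^ 'm \<Rightarrow> real ^ 'm \<Rightarrow> real ^ 'n \<Rightarrow> real \<Rightarrow> (real ^ 'n) \<times> (real ^ 'n)" where
  "z_max A b c g = (x_max A b c g, s_max A b c g)"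

end

theory Submission
  imports Defs
begin

text \<open>
  If \<open>x\<close> and \<open>(y, s)\<close> are feasible, then \<open>c \<bullet> x - b \<bullet> y = x \<bullet> s\<close>; for the central path point this gap
  is \<open>n \<mu>\<close>, so weak duality puts both of its objective values within \<open>n \<mu>\<close> of the optimum. This is
  the upper bound. Pairing any primal point of value at most \<open>v\<^sup>\<star> + n \<mu>\<close> with \<open>s\<^sup>c\<^sup>p\<close> (and dually)
  gives a gap of at most \<open>2 n \<mu>\<close>; each coordinate satisfies \<open>x\<^sub>i s\<^sub>i\<^sup>c\<^sup>p \<le> 2 n \<mu> = 2 n x\<^sub>i\<^sup>c\<^sup>p s\<^sub>i\<^sup>c\<^sup>p\<close>, which
  is the lower bound. The central path point exists because the logarithmic barrier
  \<open>s\<^sub>0 \<bullet> x - \<mu> (\<Sum>i. ln x\<^sub>i)\<close>, with \<open>s\<^sub>0\<close> a strictly feasible dual slack, has compact sublevel sets.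
\<close>

section \<open>Duality gap and inner products of nonnegative vectors\<close>

lemma duality_gap:
  fixes A :: "real ^ 'n ^ 'm"
  assumes "A *v x = b" "transpose A *v y + s = c"
  shows "c \<bullet> x = b \<bullet> y + x \<bullet> s"
proof -
  have "c \<bullet> x = (transpose A *v y) \<bullet> x + s \<bullet> x"
    using assms(2) by (auto simp: inner_add_left)
  also have "(transpose A *v y) \<bullet> x = y \<bullet> b"
    using assms(1) by (simp add: transpose_matrix_vector dot_lmul_matrix)
  finally show ?thesis by (simp add: inner_commute)
qed

lemma nonneg_mult_le_inner:
  fixes x s :: "real ^ 'n"
  assumes "\<And>i. 0 \<le> x $ i" "\<And>i. 0 \<le> s $ i"
  shows "x $ i * s $ i \<le> x \<bullet> s"
  unfolding inner_vec_def inner_real_def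
  using assms by (intro member_le_sum) auto

lemma inner_nonneg_vec:
  fixes x s :: "real ^ 'n"
  assumes "\<And>i. 0 \<le> x $ i" "\<And>i. 0 \<le> s $ i"
  shows "0 \<le> x \<bullet> s"
  unfolding inner_vec_def inner_real_def using assms by (intro sum_nonneg) auto

section \<open>Compact slices and attained extrema\<close>

text \<open>No single term \<open>x $ i * w $ i\<close> exceeds the sum, so \<open>x\<close> lies in
  the box with upper corner \<open>B / w $ i\<close>. Later \<open>w\<close> is a strictly feasible
  point of the opposite program, which turns a bound on the objective into a bound on
  \<open>x \<bullet> w\<close>.\<close>

lemma compact_nonneg_inner_le:
  fixes w :: "real ^ 'n"
  assumes "\<And>i. 0 < w $ i" "closed C"
  shows "compact {x \<in> C. (\<forall>i. 0 \<le> x $ i) \<and> x \<bullet> w \<le> B}"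
proof -
  have "x $ i \<le> B / w $ i" if "\<forall>i. 0 \<le> x $ i" "x \<bullet> w \<le> B" for x i
    using nonneg_mult_le_inner[of x w i] that assms(1)[of i] assms(1)
    by (auto simp: field_simps less_imp_le intro: order_trans)
  then have "{x \<in> C. (\<forall>i. 0 \<le> x $ i) \<and> x \<bullet> w \<le> B} \<subseteq> cbox 0 (\<chi> i. B / w $ i)"
    by (auto simp: mem_box_cart)
  then have "bounded {x \<in> C. (\<forall>i. 0 \<le> x $ i) \<and> x \<bullet> w \<le> B}"
    using bounded_cbox bounded_subset by blast
  moreover have "closed (C \<inter> {x. (\<forall>i. 0 \<le> x $ i) \<and> x \<bullet> w \<le> B})"
    using assms(2)
    by (intro closed_Int closed_Collect_conj closed_Collect_all closed_Collect_le continuous_intros)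
  moreover have "C \<inter> {x. (\<forall>i. 0 \<le> x $ i) \<and> x \<bullet> w \<le> B} = {x \<in> C. (\<forall>i. 0 \<le> x $ i) \<and> x \<bullet> w \<le> B}"
    by blast
  ultimately show ?thesis by (simp add: compact_eq_bounded_closed)
qed

lemma Greatest_compact:
  fixes S :: "real set"
  assumes "compact S" "S \<noteq> {}"
  shows "(GREATEST t. t \<in> S) \<in> S" "\<And>t. t \<in> S \<Longrightarrow> t \<le> (GREATEST t. t \<in> S)"
proof -
  obtain m where m: "m \<in> S" "\<forall>t\<in>S. t \<le> m"
    using compact_attains_sup[OF assms] by blast
  then have "(GREATEST t. t \<in> S) = m"
    by (intro Greatest_equality) auto
  with m show "(GREATEST t. t \<in> S) \<in> S" "\<And>t. t \<in> S \<Longrightarrow> t \<le> (GREATEST t. t \<in> S)" by auto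
qed

lemma compact_component_image:
  fixes K :: "(real ^ 'n) set"
  assumes "compact K"
  shows "compact {x $ i | x. x \<in> K}"
proof -
  have "compact ((\<lambda>x. x $ i) ` K)"
    using assms by (intro compact_continuous_image continuous_intros)
  then show ?thesis by (simp add: image_def Collect_conj_eq Bex_def conj_commute)
qed

text \<open>On primal feasible points \<open>c \<bullet> x\<close> and \<open>x \<bullet> s0\<close>
  differ by the constant \<open>b \<bullet> y0\<close>, so it suffices to minimize
  \<open>x \<bullet> s0\<close> over the compact slice cut off at the value of a feasible
  \<open>x0\<close>. Feasible points outside the slice are worse than every point in it.\<close>

lemma optimal_value_attained:
  fixes A :: "real ^ 'n ^ 'm"
  assumes "primal_feasible A b \<noteq> {}" "(y0, s0) \<in> dual_strictly_feasible A c"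
  shows "optimal_value A b c \<in> (\<lambda>x. c \<bullet> x) ` primal_feasible A b"
    and "\<And>x. x \<in> primal_feasible A b \<Longrightarrow> optimal_value A b c \<le> c \<bullet> x"
proof -
  obtain x0 where x0: "x0 \<in> primal_feasible A b" using assms(1) by blast
  have y0: "transpose A *v y0 + s0 = c" "\<And>i. 0 < s0 $ i"
    using assms(2) by (auto simp: dual_strictly_feasible_def)
  let ?K = "{x \<in> {x. A *v x = b}. (\<forall>i. 0 \<le> x $ i) \<and> x \<bullet> s0 \<le> x0 \<bullet> s0}"
  have "compact ?K"
    by (intro compact_nonneg_inner_le y0 closed_Collect_eq continuous_intros)
  moreover have "?K \<noteq> {}" using x0 by (auto simp: primal_feasible_def)
  moreover have "continuous_on ?K (\<lambda>x. x \<bullet> s0)" by (intro continuous_intros)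
  ultimately have "\<exists>x1\<in>?K. \<forall>x\<in>?K. x1 \<bullet> s0 \<le> x \<bullet> s0"
    by (rule continuous_attains_inf)
  then obtain x1 where x1: "x1 \<in> ?K" "\<forall>x\<in>?K. x1 \<bullet> s0 \<le> x \<bullet> s0"
    by (elim bexE)
  have gap: "c \<bullet> x = b \<bullet> y0 + x \<bullet> s0" if "x \<in> primal_feasible A b" for x
    using that y0(1) by (intro duality_gap) (auto simp: primal_feasible_def)
  have P: "x1 \<in> primal_feasible A b" using x1 by (auto simp: primal_feasible_def)
  have M: "c \<bullet> x1 \<le> c \<bullet> x" if "x \<in> primal_feasible A b" for x
  proof (cases "x \<bullet> s0 \<le> x0 \<bullet> s0")
    case True
    with that x1(2) have "x1 \<bullet> s0 \<le> x \<bullet> s0" by (auto simp: primal_feasible_def)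
    then show ?thesis using gap[OF that] gap[OF P] by simp
  next
    case False
    then show ?thesis using gap[OF that] gap[OF P] x1(1) by simp
  qed
  have "optimal_value A b c = c \<bullet> x1"
    unfolding optimal_value_def using P M by (intro Least_equality) auto
  with P M show "optimal_value A b c \<in> (\<lambda>x. c \<bullet> x) ` primal_feasible A b"
    "\<And>x. x \<in> primal_feasible A b \<Longrightarrow> optimal_value A b c \<le> c \<bullet> x" by auto
qed

text \<open>This gives \<open>GREATEST\<close> its meaning: the duality gap against
  \<open>(y0, s0)\<close> exhibits \<open>K\<close> as a compact slice, and an optimal point lies in
  it because \<open>0 \<le> g\<close>.\<close>

lemma x_max_greatest:
  fixes A :: "real ^ 'n ^ 'm"
  assumes "primal_feasible A b \<noteq> {}" "(y0, s0) \<in> dual_strictly_feasible A c" "0 \<le> g"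
  defines "K \<equiv> {x. x \<in> primal_feasible A b \<and> c \<bullet> x \<le> optimal_value A b c + g}"
  shows "\<exists>x\<in>K. x_max A b c g $ i = x $ i" "\<And>x. x \<in> K \<Longrightarrow> x $ i \<le> x_max A b c g $ i"
proof -
  have y0: "transpose A *v y0 + s0 = c" "\<And>i. 0 < s0 $ i"
    using assms(2) by (auto simp: dual_strictly_feasible_def)
  have gap: "c \<bullet> x = b \<bullet> y0 + x \<bullet> s0" if "A *v x = b" for x
    using that y0(1) by (rule duality_gap)
  have K_eq: "K = {x \<in> {x. A *v x = b}. (\<forall>i. 0 \<le> x $ i) \<and> x \<bullet> s0 \<le> optimal_value A b c + g - b \<bullet> y0}"
    unfolding K_def primal_feasible_def using gap by auto
  have "compact K"
    unfolding K_eq by (intro compact_nonneg_inner_le y0 closed_Collect_eq continuous_intros)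
  note K_greatest = Greatest_compact[OF compact_component_image[OF this, of i]]
  have "K \<noteq> {}"
    using optimal_value_attained(1)[OF assms(1,2)] assms(3) by (auto simp: K_def)
  then have ne: "{x $ i | x. x \<in> K} \<noteq> {}" by blast
  have eq: "x_max A b c g $ i = (GREATEST t. t \<in> {x $ i | x. x \<in> K})"
    by (simp add: x_max_def K_def)
  show "\<exists>x\<in>K. x_max A b c g $ i = x $ i"
    using K_greatest(1)[OF ne] unfolding eq by blast
  show "x $ i \<le> x_max A b c g $ i" if "x \<in> K" for x
    unfolding eq using that by (intro K_greatest(2)[OF ne]) blast
qed

text \<open>
  On dual feasible points \<open>b \<bullet> y = x\<^sub>0 \<bullet> (c - s)\<close> for a fixed primal \<open>x\<^sub>0\<close>, so the set of slacks is
  closed without any control of \<open>y\<close>. Nonemptiness is left as a hypothesis since it would otherwise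
  require strong duality.
\<close>

lemma s_max_greatest:
  fixes A :: "real ^ 'n ^ 'm" and c :: "real ^ 'n" and g :: real
  assumes "x0 \<in> primal_strictly_feasible A b"
  defines "K \<equiv> {(y, s). (y, s) \<in> dual_feasible A c \<and> b \<bullet> y \<ge> optimal_value A b c - g}"
  assumes "K \<noteq> {}"
  shows "\<exists>(y, s)\<in>K. s_max A b c g $ i = s $ i"
    "\<And>y s. (y, s) \<in> K \<Longrightarrow> s $ i \<le> s_max A b c g $ i"
proof -
  have x0: "A *v x0 = b" "\<And>i. 0 < x0 $ i"
    using assms(1) by (auto simp: primal_strictly_feasible_def)
  let ?C = "(\<lambda>s. c - s) -` range (\<lambda>y. transpose A *v y)"
  have gap: "c \<bullet> x0 = b \<bullet> y + x0 \<bullet> s" if "transpose A *v y + s = c" for y s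
    using x0(1) that by (rule duality_gap)
  have "closed ?C"
    by (intro closed_vimage closed_subspace linear_subspace_image subspace_UNIV
        matrix_vector_mul_linear continuous_intros)
  then have "compact {s \<in> ?C. (\<forall>i. 0 \<le> s $ i) \<and> s \<bullet> x0 \<le> c \<bullet> x0 - optimal_value A b c + g}"
    by (intro compact_nonneg_inner_le x0)
  moreover have "{s \<in> ?C. (\<forall>i. 0 \<le> s $ i) \<and> s \<bullet> x0 \<le> c \<bullet> x0 - optimal_value A b c + g} = snd ` K"
    (is "?L = _")
  proof (intro equalityI subsetI)
    fix s assume "s \<in> ?L"
    then obtain y where y: "c - s = transpose A *v y" "\<forall>i. 0 \<le> s $ i"
      "s \<bullet> x0 \<le> c \<bullet> x0 - optimal_value A b c + g" by blast
    then have "transpose A *v y + s = c" by (metis diff_add_cancel)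
    then have "(y, s) \<in> K"
      using gap[of y s] y(2,3) by (auto simp: K_def dual_feasible_def inner_commute[of s])
    then show "s \<in> snd ` K" by force
  next
    fix s assume "s \<in> snd ` K"
    then obtain y where y: "transpose A *v y + s = c" "\<forall>i. 0 \<le> s $ i"
      "b \<bullet> y \<ge> optimal_value A b c - g" by (auto simp: K_def dual_feasible_def)
    then have "s \<in> ?C" by (auto simp: image_iff algebra_simps)
    then show "s \<in> ?L" using gap[OF y(1)] y(2,3) by (auto simp: inner_commute[of s])
  qed
  ultimately have "compact (snd ` K)" by simp
  note K_greatest = Greatest_compact[OF compact_component_image[OF this, of i]]
  have ne: "{s $ i | s. s \<in> snd ` K} \<noteq> {}" using assms(3) by blast
  have eq: "s_max A b c g $ i = (GREATEST t. t \<in> {s $ i | s. s \<in> snd ` K})"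
  proof -
    have "{s $ i | s. s \<in> snd ` K} =
        {s $ i | y s. (y, s) \<in> dual_feasible A c \<and> b \<bullet> y \<ge> optimal_value A b c - g}"
      unfolding K_def by force
    then show ?thesis by (simp only: s_max_def vec_lambda_beta)
  qed
  show "\<exists>(y, s)\<in>K. s_max A b c g $ i = s $ i"
    using K_greatest(1)[OF ne] unfolding eq by fastforce
  show "s $ i \<le> s_max A b c g $ i" if "(y, s) \<in> K" for y s
    unfolding eq using that by (intro K_greatest(2)[OF ne]) force
qed

section \<open>The logarithmic barrier: coercivity, minimizer and stationarity\<close>

text \<open>This is \<open>ln u \<le> u - 1\<close> at
  \<open>u = \<sigma> * t / (2 * \<mu>)\<close>. The factor 2 spends only half of the linear term on
  the logarithm; the other half remains to bound \<open>t\<close> from above.\<close>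

lemma log_barrier_lower_bound:
  fixes \<mu> \<sigma> t :: real
  assumes "0 < \<mu>" "0 < \<sigma>" "0 < t"
  shows "\<sigma> * t / 2 + \<mu> * (1 + ln (\<sigma> / (2 * \<mu>))) \<le> \<sigma> * t - \<mu> * ln t"
proof -
  have "ln (\<sigma> / (2 * \<mu>) * t) \<le> \<sigma> / (2 * \<mu>) * t - 1"
    using assms by (intro ln_le_minus_one) simp
  moreover have "ln (\<sigma> / (2 * \<mu>) * t) = ln (\<sigma> / (2 * \<mu>)) + ln t"
    using assms by (intro ln_mult_pos) auto
  ultimately have "\<mu> * (ln (\<sigma> / (2 * \<mu>)) + ln t) \<le> \<mu> * (\<sigma> / (2 * \<mu>) * t - 1)"
    using assms by (intro mult_left_mono) auto
  also have "\<dots> = \<sigma> * t / 2 - \<mu>"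
    using assms by (simp add: field_simps)
  finally show ?thesis by (simp add: algebra_simps)
qed

text \<open>Every term is bounded below, so a bound on the sum bounds each term from above. The
  logarithm then keeps \<open>x $ i\<close> away from 0, and the spare half of the linear term keeps
  it bounded.\<close>

lemma log_barrier_sublevel_in_box:
  fixes s :: "real ^ 'n"
  assumes "0 < \<mu>" "\<And>i. 0 < s $ i"
  obtains l u where "\<And>i. 0 < l $ i"
    "\<And>x. \<lbrakk>\<And>i. 0 < x $ i; (\<Sum>i\<in>UNIV. s $ i * x $ i - \<mu> * ln (x $ i)) \<le> F\<rbrakk>
      \<Longrightarrow> x \<in> cbox l (u :: real ^ 'n)"
proof -
  \<comment> \<open>\<open>m i\<close> bounds the i-th term from below; \<open>G i\<close> is what
    the bound \<open>F\<close> leaves for term \<open>i\<close> once the others take at least their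
    lower bounds.\<close>
  define m where "m i = \<mu> * (1 + ln (s $ i / (2 * \<mu>)))" for i
  define G where "G i = F - (\<Sum>j\<in>UNIV - {i}. m j)" for i
  show ?thesis
  proof
    show "0 < (\<chi> i. exp (- G i / \<mu>)) $ i" for i by simp
    fix x :: "real ^ 'n"
    assume x: "\<And>i. 0 < x $ i" and F: "(\<Sum>i\<in>UNIV. s $ i * x $ i - \<mu> * ln (x $ i)) \<le> F"
    let ?\<phi> = "\<lambda>i. s $ i * x $ i - \<mu> * ln (x $ i)"
    have low: "s $ i * x $ i / 2 + m i \<le> ?\<phi> i" for i
      unfolding m_def using assms x by (intro log_barrier_lower_bound)
    have "m j \<le> ?\<phi> j" for j
      using low[of j] mult_pos_pos[OF assms(2)[of j] x[of j]] by simp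
    then have "(\<Sum>j\<in>UNIV - {i}. m j) \<le> (\<Sum>j\<in>UNIV - {i}. ?\<phi> j)" for i
      by (intro sum_mono)
    moreover have "(\<Sum>j\<in>UNIV. ?\<phi> j) = ?\<phi> i + (\<Sum>j\<in>UNIV - {i}. ?\<phi> j)" for i
      by (intro sum.remove) auto
    ultimately have up: "?\<phi> i \<le> G i" for i
      using F unfolding G_def by (smt (verit))
    have "exp (- G i / \<mu>) \<le> x $ i \<and> x $ i \<le> 2 * (G i - m i) / s $ i" for i
    proof
      have "0 < s $ i * x $ i" using assms x by simp
      then have "- G i \<le> \<mu> * ln (x $ i)" using up[of i] by linarith
      then have "- G i / \<mu> \<le> ln (x $ i)" using assms(1) by (simp add: field_simps)
      then show "exp (- G i / \<mu>) \<le> x $ i" using x[of i] by (simp add: ln_ge_iff)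
      have "s $ i * x $ i / 2 + m i \<le> G i" using low up by (rule order_trans)
      then show "x $ i \<le> 2 * (G i - m i) / s $ i" using assms(2)[of i] by (simp add: field_simps)
    qed
    then show "x \<in> cbox (\<chi> i. exp (- G i / \<mu>)) (\<chi> i. 2 * (G i - m i) / s $ i)"
      by (simp add: mem_box_cart)
  qed
qed

text \<open>The box around the sublevel set of a strictly feasible \<open>x0\<close> has a positive
  lower corner, so the barrier is continuous on its compact intersection with
  \<open>A *v x = b\<close>. Strictly feasible points outside this intersection have values above
  that of \<open>x0\<close>.\<close>

lemma log_barrier_minimizer:
  fixes A :: "real ^ 'n ^ 'm"
  assumes "0 < \<mu>" "\<And>i. 0 < s $ i" "primal_strictly_feasible A b \<noteq> {}"
  obtains x where "x \<in> primal_strictly_feasible A b"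
    "\<And>x'. x' \<in> primal_strictly_feasible A b \<Longrightarrow>
      (\<Sum>i\<in>UNIV. s $ i * x $ i - \<mu> * ln (x $ i)) \<le> (\<Sum>i\<in>UNIV. s $ i * x' $ i - \<mu> * ln (x' $ i))"
proof -
  let ?f = "\<lambda>x :: real ^ 'n. \<Sum>i\<in>UNIV. s $ i * x $ i - \<mu> * ln (x $ i)"
  obtain x0 where x0: "x0 \<in> primal_strictly_feasible A b" using assms(3) by blast
  obtain l u where l: "\<And>i. 0 < l $ i"
    and box: "\<And>x. \<lbrakk>\<And>i. 0 < x $ i; ?f x \<le> ?f x0\<rbrakk> \<Longrightarrow> x \<in> cbox l u"
    using log_barrier_sublevel_in_box[OF assms(1,2), of "?f x0"] by blast
  let ?K = "cbox l u \<inter> {x. A *v x = b}"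
  have pos: "0 < x $ i" if "x \<in> cbox l u" for x i
    using that l[of i] by (auto simp: mem_box_cart intro: less_le_trans)
  have "compact ?K"
    by (intro compact_Int_closed compact_cbox closed_Collect_eq continuous_intros)
  moreover have x0K: "x0 \<in> ?K"
    using x0 box[of x0] by (auto simp: primal_strictly_feasible_def)
  moreover have "continuous_on ?K ?f"
    by (intro continuous_intros ballI) (use pos in \<open>auto simp: less_imp_neq[symmetric]\<close>)
  ultimately obtain x1 where x1: "x1 \<in> ?K" "\<And>x. x \<in> ?K \<Longrightarrow> ?f x1 \<le> ?f x"
    using continuous_attains_inf[of ?K ?f] by blast
  show ?thesis
  proof
    show "x1 \<in> primal_strictly_feasible A b"
      using x1(1) pos by (auto simp: primal_strictly_feasible_def)
    show "?f x1 \<le> ?f x'" if "x' \<in> primal_strictly_feasible A b" for x'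
    proof (cases "?f x' \<le> ?f x0")
      case True
      with that have "x' \<in> ?K" using box[of x'] by (auto simp: primal_strictly_feasible_def)
      then show ?thesis by (rule x1(2))
    next
      case False
      then show ?thesis using x1(2)[OF x0K] by linarith
    qed
  qed
qed

lemma orthogonal_kernel_in_range_transpose:
  fixes A :: "real ^ 'n ^ 'm"
  assumes "\<And>d. A *v d = 0 \<Longrightarrow> v \<bullet> d = 0"
  shows "v \<in> range (\<lambda>y. transpose A *v y)"
proof -
  let ?R = "range (\<lambda>y. transpose A *v y)"
  have sub: "subspace ?R"
    by (intro linear_subspace_image subspace_UNIV matrix_vector_mul_linear)
  have "v \<bullet> d = 0" if d: "d \<in> orthogonal_comp ?R" for d
  proof (rule assms)
    \<comment> \<open>Testing \<open>d\<close> against the image of \<open>A *v d\<close> gives the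
      squared norm of \<open>A *v d\<close>.\<close>
    have "(transpose A *v (A *v d)) \<bullet> d = 0"
      using d by (auto simp: orthogonal_comp_def orthogonal_def inner_commute)
    then show "A *v d = 0"
      by (simp add: transpose_matrix_vector dot_lmul_matrix)
  qed
  then have "v \<in> orthogonal_comp (orthogonal_comp ?R)"
    by (auto simp: orthogonal_comp_def orthogonal_def inner_commute)
  then show ?thesis using orthogonal_comp_self[OF sub] by simp
qed

text \<open>Along the line \<open>x + t *\<^sub>R d\<close> the equation \<open>A *v x = b\<close>
  persists, and positivity persists for small \<open>t\<close>. The barrier restricted to this line
  has a local minimum at \<open>t = 0\<close>, where its derivative is the stated sum.\<close>

lemma log_barrier_stationary:
  fixes A :: "real ^ 'n ^ 'm"
  assumes x: "x \<in> primal_strictly_feasible A b"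
    and min: "\<And>x'. x' \<in> primal_strictly_feasible A b \<Longrightarrow>
      (\<Sum>i\<in>UNIV. s $ i * x $ i - \<mu> * ln (x $ i)) \<le> (\<Sum>i\<in>UNIV. s $ i * x' $ i - \<mu> * ln (x' $ i))"
    and d: "A *v d = 0"
  shows "(\<Sum>i\<in>UNIV. (s $ i - \<mu> / x $ i) * d $ i) = 0"
proof -
  have x': "A *v x = b" "\<And>i. 0 < x $ i" using x by (auto simp: primal_strictly_feasible_def)
  let ?h = "\<lambda>t. \<Sum>i\<in>UNIV. s $ i * (x $ i + t * d $ i) - \<mu> * ln (x $ i + t * d $ i)"
  have "eventually (\<lambda>t. 0 < x $ i + t * d $ i) (at 0)" for i
  proof (rule order_tendstoD)
    show "((\<lambda>t. x $ i + t * d $ i) \<longlongrightarrow> x $ i + 0 * d $ i) (at 0)"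
      by (intro tendsto_intros)
  qed (use x' in simp)
  then have "eventually (\<lambda>t. \<forall>i. 0 < x $ i + t * d $ i) (at 0)"
    by (simp add: eventually_all_finite)
  then obtain r where r: "0 < r" "\<And>t i. \<lbrakk>t \<noteq> 0; dist t 0 < r\<rbrakk> \<Longrightarrow> 0 < x $ i + t * d $ i"
    unfolding eventually_at by blast
  have "?h 0 \<le> ?h t" if "\<bar>0 - t\<bar> < r" for t
  proof -
    have "x + t *\<^sub>R d \<in> primal_strictly_feasible A b"
      using r(2)[of t] that x' d
      by (cases "t = 0") (auto simp: primal_strictly_feasible_def matrix_vector_right_distrib
          matrix_vector_mult_scaleR)
    from min[OF this] show ?thesis by simp
  qed
  moreover have "(?h has_real_derivative (\<Sum>i\<in>UNIV. (s $ i - \<mu> / x $ i) * d $ i)) (at 0)"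
    using x'(2)
    by (auto intro!: derivative_eq_intros sum.cong simp: algebra_simps)
  ultimately show ?thesis
    using DERIV_local_min[of ?h _ 0 r] r(1) by blast
qed

section \<open>Existence and uniqueness of the central path point\<close>

lemma central_path_exists:
  fixes A :: "real ^ 'n ^ 'm"
  assumes "primal_strictly_feasible A b \<noteq> {}" "dual_strictly_feasible A c \<noteq> {}" "0 < \<mu>"
  obtains x y s where "x \<in> primal_strictly_feasible A b" "(y, s) \<in> dual_strictly_feasible A c"
    "\<forall>i. x $ i * s $ i = \<mu>"
proof -
  obtain y0 s0 where y0: "transpose A *v y0 + s0 = c" "\<And>i. 0 < s0 $ i"
    using assms(2) by (auto simp: dual_strictly_feasible_def)
  obtain x where x: "x \<in> primal_strictly_feasible A b"
    "\<And>x'. x' \<in> primal_strictly_feasible A b \<Longrightarrow>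
      (\<Sum>i\<in>UNIV. s0 $ i * x $ i - \<mu> * ln (x $ i)) \<le> (\<Sum>i\<in>UNIV. s0 $ i * x' $ i - \<mu> * ln (x' $ i))"
    using log_barrier_minimizer[OF assms(3) y0(2) assms(1)] by blast
  have pos: "\<And>i. 0 < x $ i" using x(1) by (auto simp: primal_strictly_feasible_def)
  \<comment> \<open>This slack is forced by \<open>x $ i * s $ i = \<mu>\<close>. Stationarity makes
    \<open>s0 - s\<close> orthogonal to the kernel of \<open>A\<close>, so it equals
    \<open>transpose A *v w\<close> for some \<open>w\<close>, and shifting \<open>y0\<close> by
    \<open>w\<close> restores dual feasibility.\<close>
  define s where "s = (\<chi> i. \<mu> / x $ i)"
  have "(s0 - s) \<bullet> d = 0" if "A *v d = 0" for d
    using log_barrier_stationary[OF x that] by (simp add: inner_vec_def s_def)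
  then obtain w where w: "s0 - s = transpose A *v w"
    using orthogonal_kernel_in_range_transpose[of A "s0 - s"] by blast
  have "transpose A *v (y0 + w) + s = c"
    using y0(1) w by (metis add.assoc diff_add_cancel matrix_vector_right_distrib)
  then have "(y0 + w, s) \<in> dual_strictly_feasible A c"
    using pos assms(3) by (auto simp: dual_strictly_feasible_def s_def)
  moreover have "x $ i * s $ i = \<mu>" for i
    using pos[of i] by (simp add: s_def)
  ultimately show ?thesis using that x(1) by blast
qed

text \<open>\<open>x1 - x2\<close> lies in the kernel of \<open>A\<close> and \<open>s2 - s1\<close>
  in the range of its transpose, so they are orthogonal. Equal products make each term of their
  inner product a positive multiple of \<open>(x1 $ i - x2 $ i)\<^sup>2\<close>, hence every term
  vanishes.\<close>

lemma central_path_unique: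
  fixes A :: "real ^ 'n ^ 'm"
  assumes "rank A = CARD('m)"
    and 1: "x1 \<in> primal_strictly_feasible A b" "(y1, s1) \<in> dual_strictly_feasible A c"
      "\<And>i. x1 $ i * s1 $ i = \<mu>"
    and 2: "x2 \<in> primal_strictly_feasible A b" "(y2, s2) \<in> dual_strictly_feasible A c"
      "\<And>i. x2 $ i * s2 $ i = \<mu>"
  shows "(x1, y1, s1) = (x2, y2, s2)"
proof -
  note defs = primal_strictly_feasible_def dual_strictly_feasible_def
  have x: "A *v x1 = b" "A *v x2 = b" "\<And>i. 0 < x1 $ i" "\<And>i. 0 < x2 $ i"
    using 1 2 by (auto simp: defs)
  have s: "transpose A *v y1 + s1 = c" "transpose A *v y2 + s2 = c"
    "\<And>i. 0 < s1 $ i" "\<And>i. 0 < s2 $ i"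
    using 1 2 by (auto simp: defs)
  have "(x1 - x2) \<bullet> (s2 - s1) = 0"
    using duality_gap[OF x(1) s(1)] duality_gap[OF x(1) s(2)] duality_gap[OF x(2) s(1)]
      duality_gap[OF x(2) s(2)] by (simp add: inner_diff)
  then have sum0: "(\<Sum>i\<in>UNIV. (x1 $ i - x2 $ i) * (s2 $ i - s1 $ i)) = 0"
    by (simp add: inner_vec_def)
  have term_eq: "(x1 $ i - x2 $ i) * (s2 $ i - s1 $ i) = (x1 $ i - x2 $ i)\<^sup>2 * (s1 $ i / x2 $ i)" for i
  proof -
    have "x2 $ i * (s2 $ i - s1 $ i) = (x1 $ i - x2 $ i) * s1 $ i"
      using 1(3)[of i] 2(3)[of i] by (simp add: algebra_simps)
    then have "s2 $ i - s1 $ i = (x1 $ i - x2 $ i) * s1 $ i / x2 $ i"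
      using x(4)[of i] by (simp add: field_simps)
    then show ?thesis by (simp add: power2_eq_square)
  qed
  have pos: "0 < s1 $ i / x2 $ i" for i using s(3) x(4) by simp
  have "0 \<le> (x1 $ i - x2 $ i)\<^sup>2 * (s1 $ i / x2 $ i)" for i
    by (intro mult_nonneg_nonneg less_imp_le[OF pos]) simp
  then have "(x1 $ i - x2 $ i)\<^sup>2 * (s1 $ i / x2 $ i) = 0" for i
    using sum_nonneg_0[OF finite _ sum0[unfolded term_eq]] by blast
  then have "x1 $ i = x2 $ i" for i
    using pos[of i] by (metis eq_iff_diff_eq_0 less_irrefl mult_eq_0_iff power_eq_0_iff)
  then have x_eq: "x1 = x2" by (simp add: vec_eq_iff)
  have "s1 $ i = s2 $ i" for i
    using 1(3)[of i] 2(3)[of i] x(4)[of i] x_eq by (metis less_irrefl mult_left_cancel)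
  then have s_eq: "s1 = s2" by (simp add: vec_eq_iff)
  \<comment> \<open>Equal slacks only give equal images under the transpose; full row rank recovers
    \<open>y\<close>.\<close>
  have "inj (\<lambda>y. transpose A *v y)"
    using assms(1) full_rank_injective[of "transpose A"]
    by (simp add: rank_transpose del: transpose_matrix_vector)
  moreover have "transpose A *v y1 = transpose A *v y2"
    using s(1,2) s_eq by (metis add_right_cancel)
  ultimately have "y1 = y2" by (simp add: inj_def)
  with x_eq s_eq show ?thesis by simp
qed

lemma z_cp_central:
  fixes A :: "real ^ 'n ^ 'm"
  assumes "rank A = CARD('m)" "primal_strictly_feasible A b \<noteq> {}"
    "dual_strictly_feasible A c \<noteq> {}" "0 < \<mu>"
  obtains x y s where "z_cp A b c \<mu> = (x, s)" "x \<in> primal_strictly_feasible A b"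
    "(y, s) \<in> dual_strictly_feasible A c" "\<forall>i. x $ i * s $ i = \<mu>"
proof -
  obtain x y s where xs: "x \<in> primal_strictly_feasible A b" "(y, s) \<in> dual_strictly_feasible A c"
    "\<forall>i. x $ i * s $ i = \<mu>"
    using central_path_exists[OF assms(2-4)] by blast
  have "central_path A b c \<mu> = (x, y, s)"
    unfolding central_path_def
  proof (rule the_equality)
    fix z assume "case z of (x, y, s) \<Rightarrow> x \<in> primal_strictly_feasible A b \<and>
      (y, s) \<in> dual_strictly_feasible A c \<and> (\<forall>i. x $ i * s $ i = \<mu>)"
    moreover obtain x' y' s' where "z = (x', y', s')" by (cases z)
    ultimately show "z = (x, y, s)"
      using central_path_unique[OF assms(1) _ _ _ xs(1,2) xs(3)[rule_format], of x' y' s'] by simp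
  qed (use xs in simp)
  then have "z_cp A b c \<mu> = (x, s)" by (simp add: z_cp_def)
  with xs show ?thesis using that by blast
qed

section \<open>Comparison of the central path with the max central path\<close>

theorem lemma1p2:
  fixes A :: "real ^ 'n ^ 'm" and b :: "real ^ 'm" and c :: "real ^ 'n" and \<mu> :: real
  assumes "rank A = CARD('m)"
    and "primal_strictly_feasible A b \<noteq> {}"
    and "dual_strictly_feasible A c \<noteq> {}"
    and "\<mu> > 0"
  shows "z_max A b c (real CARD('n) * \<mu>) /\<^sub>R (2 * real CARD('n)) \<le> z_cp A b c \<mu> \<and>
    z_cp A b c \<mu> \<le> z_max A b c (real CARD('n) * \<mu>)"
proof -
  let ?n = "real CARD('n)" and ?v = "optimal_value A b c"
  obtain x y s where z: "z_cp A b c \<mu> = (x, s)" and cp: "x \<in> primal_strictly_feasible A b"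
    "(y, s) \<in> dual_strictly_feasible A c" "\<forall>i. x $ i * s $ i = \<mu>"
    by (rule z_cp_central[OF assms]) (rule that)
  have x: "A *v x = b" "\<And>i. 0 < x $ i" "x \<in> primal_feasible A b"
    using cp(1) by (auto simp: primal_strictly_feasible_def primal_feasible_def less_imp_le)
  have s: "transpose A *v y + s = c" "\<And>i. 0 < s $ i" "(y, s) \<in> dual_feasible A c"
    using cp(2) by (auto simp: dual_strictly_feasible_def dual_feasible_def less_imp_le)
  have ne: "primal_feasible A b \<noteq> {}" using x(3) by blast
  note opt = optimal_value_attained[OF ne cp(2)]
  obtain xo where xo: "xo \<in> primal_feasible A b" "?v = c \<bullet> xo" using opt(1) by blast
  have weak: "b \<bullet> y \<le> ?v"
    using duality_gap[of A xo b y s c] xo s inner_nonneg_vec[of xo s]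
    by (simp add: primal_feasible_def less_imp_le)
  have gap: "c \<bullet> x = b \<bullet> y + ?n * \<mu>"
    using duality_gap[OF x(1) s(1)] cp(3) by (simp add: inner_vec_def)
  have v_le: "?v \<le> c \<bullet> x" by (rule opt(2)[OF x(3)])
  have n: "0 < ?n" by simp
  have coord: "p /\<^sub>R (2 * ?n) \<le> q" if "p * r \<le> 2 * ?n * \<mu>" "q * r = \<mu>" "0 < r" for p q r :: real
  proof -
    have "p * r \<le> (2 * ?n * q) * r" using that(1,2) by (simp add: mult.assoc)
    then have "p \<le> 2 * ?n * q" using that(3) by simp
    then show ?thesis using n by (simp add: field_simps)
  qed
  have g: "0 \<le> ?n * \<mu>" using assms(4) by simp
  note xm = x_max_greatest[OF ne cp(2) g]
  \<comment> \<open>The central path point itself witnesses nonemptiness: its dual value is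
    \<open>c \<bullet> x - ?n * \<mu>\<close>, at least \<open>?v - ?n * \<mu>\<close>.\<close>
  have ysK: "(y, s) \<in> {(y, s). (y, s) \<in> dual_feasible A c \<and> b \<bullet> y \<ge> ?v - ?n * \<mu>}"
    using s(3) gap v_le by simp
  then have "{(y, s). (y, s) \<in> dual_feasible A c \<and> b \<bullet> y \<ge> ?v - ?n * \<mu>} \<noteq> {}" by blast
  note sm = s_max_greatest[OF cp(1) this]
  have x_up: "x $ i \<le> x_max A b c (?n * \<mu>) $ i" for i
    using xm(2)[of x i] x(3) gap weak by simp
  have s_up: "s $ i \<le> s_max A b c (?n * \<mu>) $ i" for i
    by (rule sm(2)[OF ysK])
  have x_low: "x_max A b c (?n * \<mu>) $ i /\<^sub>R (2 * ?n) \<le> x $ i" for i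
  proof -
    obtain x' where x': "x' \<in> primal_feasible A b" "c \<bullet> x' \<le> ?v + ?n * \<mu>"
      and eq: "x_max A b c (?n * \<mu>) $ i = x' $ i"
      using xm(1)[of i] by blast
    have "x' $ i * s $ i \<le> x' \<bullet> s"
      using x'(1) s(2) by (intro nonneg_mult_le_inner) (auto simp: primal_feasible_def less_imp_le)
    \<comment> \<open>One \<open>?n * \<mu>\<close> is the slack allowed to \<open>x'\<close> above
      \<open>?v\<close>; the other bounds \<open>?v - b \<bullet> y\<close>, since
      \<open>?v \<le> c \<bullet> x\<close>.\<close>
    also have "\<dots> \<le> 2 * ?n * \<mu>"
      using duality_gap[of A x' b y s c] x' s(1) gap v_le by (simp add: primal_feasible_def)
    finally show ?thesis unfolding eq using cp(3) s(2) by (intro coord[of _ "s $ i"]) auto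
  qed
  have s_low: "s_max A b c (?n * \<mu>) $ i /\<^sub>R (2 * ?n) \<le> s $ i" for i
  proof -
    obtain y' s' where s': "(y', s') \<in> dual_feasible A c" "b \<bullet> y' \<ge> ?v - ?n * \<mu>"
      and eq: "s_max A b c (?n * \<mu>) $ i = s' $ i"
      using sm(1)[of i] by blast
    have "s' $ i * x $ i \<le> s' \<bullet> x"
      using s'(1) x(2) by (intro nonneg_mult_le_inner) (auto simp: dual_feasible_def less_imp_le)
    \<comment> \<open>Symmetrically, \<open>c \<bullet> x\<close> exceeds \<open>?v\<close> by at
      most \<open>?n * \<mu>\<close> by weak duality, and \<open>b \<bullet> y'\<close> falls below
      \<open>?v\<close> by at most as much.\<close>
    also have "\<dots> \<le> 2 * ?n * \<mu>"
      using duality_gap[of A x b y' s' c] s' x(1) gap weak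
      by (simp add: dual_feasible_def inner_commute)
    finally show ?thesis
      unfolding eq using cp(3) x(2) by (intro coord[of _ "x $ i"]) (auto simp: mult.commute)
  qed
  show ?thesis
    unfolding z z_max_def scaleR_Pair Pair_le less_eq_vec_def vector_scaleR_component
    using x_up s_up x_low s_low by blast
qed

end
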